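(* Let $E=\{s,t,u,u',v_1,\dots,v_5,w_1,\dots,w_5\}$ (14 distinct elements), and let $\mathcal{B}$ be the collection of the following subsets of $E$: $\{s,u,u'\}$; $\{t,u,u'\}$; $\{s,t,u\}$, $\{s,t,u'\}$; $\{s,u,v_i\}$, $\{s,u',v_i\}$ for all $i$; $\{t,u,w_i\}$, $\{t,u',w_i\}$ for all $i$; $\{u,u',v_i\}$, $\{u,u',w_i\}$ for all $i$; and $\{u,v_i,w_j\}$, $\{u',v_i,w_j\}$ for all $i,j$ (with $i,j\in\{1,\dots,5\}$). Then $(E,\mathcal{B})$ is a rank-$3$ matroid; it is the $\mathbb{R}$-linear matroid in which the elements are identified with the vectors $s=(1,0,0)$, $t=(0,1,0)$, $u=(0,0,1)$, $u'=(1,1,1)$, $v_i=(0,1,0)$, $w_i=(1,0,0)$ in $\mathbb{R}^3$ (bases being the $3$-element subsets of $E$ whose vectors are linearly independent). The Ollivier--Ricci curvature $\kappa$ of its basis exchange walk satisfies \[\kappa\leq -\frac{1}{21},\] so the basis exchange walk is negatively curved.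
   Context: A matroid $\mathcal{M}=(E,\mathcal{B})$ is a finite set $E$ with a non-empty collection $\mathcal{B}$ of subsets (bases) such that no proper subset of a basis is a basis and the basis exchange property holds; its rank $k$ is the common size of its bases. We write $B-u$ for $B\setminus\{u\}$. The basis exchange walk (down-up walk) on $\mathcal{M}$ is the Markov chain $P$ on $\mathcal{B}$ that from $S\in\mathcal{B}$ drops an element $u\in S$ chosen uniformly at random, then moves to a uniformly random basis containing $S-u$ (possibly $S$ itself). The metric on $\mathcal{B}$ is $d(S,T)=\inf\{t\ge 0: P^t(S,T)>0\}$. The Wasserstein distance is $\mathcal{W}(\mu,\nu)=\min \mathbb{E}\, d(X,Y)$, the minimum being over all couplings $(X,Y)$ of $X\sim\mu$ and $Y\sim\nu$. The Ollivier--Ricci curvature $\kappa$ of $P$ is the largest $\kappa$ such that $\mathcal{W}(P(S,\cdot),P(T,\cdot))\le(1-\kappa)\,d(S,T)$ for all $S,T\in\mathcal{B}$, i.e. $\kappa=\inf_{S\ne T}\left(1-\mathcal{W}(P(S,\cdot),P(T,\cdot))/d(S,T)\right)$. Negatively curved means $\kappa<0$. *)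

theory Defs
  imports "HOL-Probability.Probability"
begin

definition is_matroid :: "'a set \<Rightarrow> 'a set set \<Rightarrow> bool" where
  "is_matroid E \<B> \<longleftrightarrow>
     finite E \<and> \<B> \<subseteq> Pow E \<and> \<B> \<noteq> {} \<and>
     (\<forall>S\<in>\<B>. \<forall>T\<in>\<B>. \<not> S \<subset> T) \<and>
     (\<forall>S\<in>\<B>. \<forall>T\<in>\<B>. \<forall>x\<in>S - T. \<exists>y\<in>T - S. insert y (S - {x}) \<in> \<B>)"

definition is_matroid_of_rank :: "'a set \<Rightarrow> 'a set set \<Rightarrow> nat \<Rightarrow> bool" where
  "is_matroid_of_rank E \<B> k \<longleftrightarrow> is_matroid E \<B> \<and> (\<forall>S\<in>\<B>. card S = k)"

text \<open>The vectors of the elements of \<open>A\<close> are independent as a family: \<open>independent (\<phi> ` A)\<close> alone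
  would also accept sets \<open>A\<close> containing two elements with the same vector.\<close>

definition linear_bases :: "('a \<Rightarrow> 'v::real_vector) \<Rightarrow> 'a set \<Rightarrow> nat \<Rightarrow> 'a set set" where
  "linear_bases \<phi> E k = {A. A \<subseteq> E \<and> card A = k \<and> inj_on \<phi> A \<and> independent (\<phi> ` A)}"

text \<open>A Markov chain is given by its transition kernel \<open>K\<close>, where \<open>K x\<close> is the law of the next
  state after \<open>x\<close>.\<close>

primrec kernel_power :: "('s \<Rightarrow> 's pmf) \<Rightarrow> nat \<Rightarrow> 's \<Rightarrow> 's pmf" where
  "kernel_power K 0 x = return_pmf x"
| "kernel_power K (Suc t) x = bind_pmf (K x) (kernel_power K t)"

text \<open>\<open>Inf\<close> on \<open>nat\<close> is \<open>0\<close> on the empty set; \<open>basis_exchange_walk_irreducible\<close> below shows that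
  this case does not arise for two bases of a matroid.\<close>

definition chain_dist :: "('s \<Rightarrow> 's pmf) \<Rightarrow> 's \<Rightarrow> 's \<Rightarrow> nat" where
  "chain_dist K x y = Inf {t. pmf (kernel_power K t x) y > 0}"

definition couplings :: "'s pmf \<Rightarrow> 's pmf \<Rightarrow> ('s \<times> 's) pmf set" where
  "couplings \<mu> \<nu> = {\<pi>. map_pmf fst \<pi> = \<mu> \<and> map_pmf snd \<pi> = \<nu>}"

text \<open>For finitely supported \<open>\<mu>\<close> and \<open>\<nu>\<close> the couplings form a nonempty compact polytope, so the
  infimum is a minimum.\<close>

definition wasserstein :: "('s \<Rightarrow> 's \<Rightarrow> nat) \<Rightarrow> 's pmf \<Rightarrow> 's pmf \<Rightarrow> real" where
  "wasserstein d \<mu> \<nu> =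
     (INF \<pi>\<in>couplings \<mu> \<nu>. measure_pmf.expectation \<pi> (\<lambda>(x, y). real (d x y)))"

text \<open>For a finite state space \<open>X\<close> with at least two elements this is the infimum of a finite
  nonempty set.\<close>

definition ollivier_ricci_curvature :: "'s set \<Rightarrow> ('s \<Rightarrow> 's pmf) \<Rightarrow> real" where
  "ollivier_ricci_curvature X K =
     (INF (x, y)\<in>{(x, y). x \<in> X \<and> y \<in> X \<and> x \<noteq> y}.
        1 - wasserstein (chain_dist K) (K x) (K y) / real (chain_dist K x y))"

definition negatively_curved :: "'s set \<Rightarrow> ('s \<Rightarrow> 's pmf) \<Rightarrow> bool" where
  "negatively_curved X K \<longleftrightarrow> ollivier_ricci_curvature X K < 0"

definition basis_exchange_walk :: "'a set set \<Rightarrow> 'a set \<Rightarrow> 'a set pmf" where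
  "basis_exchange_walk \<B> S =
     bind_pmf (pmf_of_set S) (\<lambda>x. pmf_of_set {T \<in> \<B>. S - {x} \<subseteq> T})"

lemma basis_exchange_walk_irreducible:
  assumes "is_matroid E \<B>" "S \<in> \<B>" "T \<in> \<B>"
  shows "\<exists>t. pmf (kernel_power (basis_exchange_walk \<B>) t S) T > 0"
  using assms(2)
proof (induction "card (S - T)" arbitrary: S rule: less_induct)
  case less
  have finE: "finite E" and sub: "\<B> \<subseteq> Pow E" using assms(1) by (auto simp: is_matroid_def)
  have finB: "finite \<B>" using finE sub by (meson finite_Pow_iff finite_subset)
  have finS: "finite S" using finE sub less.prems by (meson PowD finite_subset subsetD)
  show ?case
  proof (cases "S - T = {}")
    case True
    then have "S = T" using assms(1,3) less.prems by (auto simp: is_matroid_def)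
    then have "pmf (kernel_power (basis_exchange_walk \<B>) 0 S) T > 0" by simp
    then show ?thesis ..
  next
    case False
    then obtain x where x: "x \<in> S - T" by blast
    with assms less.prems obtain y where y: "y \<in> T - S" "insert y (S - {x}) \<in> \<B>"
      unfolding is_matroid_def by meson
    define R where "R = insert y (S - {x})"
    have "R - T = (S - T) - {x}" using y by (auto simp: R_def)
    then have "card (R - T) < card (S - T)"
      using x finS by (metis card_Diff1_less finite_Diff)
    then obtain t where t: "pmf (kernel_power (basis_exchange_walk \<B>) t R) T > 0"
      using less.hyps y(2) unfolding R_def by blast
    have ne: "{Q \<in> \<B>. S - {x} \<subseteq> Q} \<noteq> {}" using less.prems by blast
    have "R \<in> set_pmf (pmf_of_set {Q \<in> \<B>. S - {x} \<subseteq> Q})"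
      using finB ne y(2) by (subst set_pmf_of_set) (auto simp: R_def)
    moreover have "x \<in> set_pmf (pmf_of_set S)"
      using finS x by (subst set_pmf_of_set) auto
    ultimately have "R \<in> set_pmf (basis_exchange_walk \<B> S)"
      by (auto simp: basis_exchange_walk_def)
    moreover have "T \<in> set_pmf (kernel_power (basis_exchange_walk \<B>) t R)"
      using t by (simp add: set_pmf_iff)
    ultimately have "T \<in> set_pmf (kernel_power (basis_exchange_walk \<B>) (Suc t) S)"
      by auto
    then show ?thesis by (meson pmf_positive)
  qed
qed

end

(*
  Four parallel classes of elements occur: those of (1,0,0), (0,1,0), (0,0,1) and (1,1,1). Any
  three of these vectors are independent, so a basis is a set of three pairwise non-parallel
  elements.

  For the curvature take S = {s,u,u'}, T = {t,u,u'} and F = {t,w_1,...,w_5}. One step of the walk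
  changes card (B \<inter> F) by at most one, so B \<mapsto> card (B \<inter> F) is 1-Lipschitz and, by the easy half of
  Kantorovich duality, the difference of its means under P(T,.) and P(S,.) bounds the Wasserstein
  distance from below. The steps that drop s resp. t contribute equally to the two means; after
  dropping u or u' the mean is 1/7 from S and 1 + 5/7 from T. This gives 2/3 * 11/7 = 22/21,
  while d(S,T) = 1.
*)

theory Submission
  imports Defs
begin

section \<open>Truncated partition matroids\<close>

text \<open>When nonempty, this is the collection of bases of the rank-\<open>k\<close> truncation
  of the partition matroid whose classes are the fibres of \<open>c\<close>. With \<open>c\<close>
  the vector of an element, the possible replacements in an exchange can be read off from the
  parallel classes alone.\<close>

definition partition_bases :: "('a \<Rightarrow> 'b) \<Rightarrow> 'a set \<Rightarrow> nat \<Rightarrow> 'a set set" where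
  "partition_bases c E k = {A. A \<subseteq> E \<and> card A = k \<and> inj_on c A}"

text \<open>After removing \<open>x\<close>, the basis \<open>S\<close> meets fewer classes than
  \<open>T\<close>, so some \<open>y\<close> in \<open>T\<close> lies in a class that is now free.
  This \<open>y\<close> is outside \<open>S\<close>: it avoids \<open>S - {x}\<close> by its class,
  and it differs from \<open>x\<close> because \<open>x\<close> is not in \<open>T\<close>.\<close>

lemma is_matroid_of_rank_partition_bases:
  assumes fin: "finite E" and ne: "partition_bases c E k \<noteq> {}"
  shows "is_matroid_of_rank E (partition_bases c E k) k"
proof -
  let ?B = "partition_bases c E k"
  have finA: "finite A" if "A \<in> ?B" for A
    using that fin by (auto simp: partition_bases_def intro: finite_subset)
  have "\<not> S \<subset> T" if "S \<in> ?B" "T \<in> ?B" for S T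
    using psubset_card_mono[OF finA[OF that(2)], of S] that by (auto simp: partition_bases_def)
  moreover have "\<exists>y\<in>T - S. insert y (S - {x}) \<in> ?B"
    if S: "S \<in> ?B" and T: "T \<in> ?B" and x: "x \<in> S - T" for S T x
  proof -
    have "card (c ` (S - {x})) \<le> card (S - {x})"
      using finA[OF S] by (intro card_image_le) auto
    also have "\<dots> < card S" using x finA[OF S] by (intro card_Diff1_less) auto
    also have "\<dots> = card (c ` T)"
      using S T by (simp add: partition_bases_def card_image)
    finally have "\<not> c ` T \<subseteq> c ` (S - {x})"
      using finA[OF S] by (meson card_mono finite_Diff finite_imageI not_le)
    then obtain y where y: "y \<in> T" "c y \<notin> c ` (S - {x})" by blast
    then have "y \<notin> S" using x by auto
    moreover have "insert y (S - {x}) \<in> ?B"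
    proof -
      have "card (insert y (S - {x})) = card S"
        using x \<open>y \<notin> S\<close> finA[OF S] by (simp add: card_Suc_Diff1 del: card_Diff_insert)
      moreover have "inj_on c (insert y (S - {x}))"
        using S y by (auto simp: partition_bases_def inj_on_insert intro: inj_on_subset)
      ultimately show ?thesis using S T y by (auto simp: partition_bases_def)
    qed
    ultimately show ?thesis using y by blast
  qed
  moreover have "?B \<subseteq> Pow E" "\<forall>S\<in>?B. card S = k" by (auto simp: partition_bases_def)
  ultimately show ?thesis
    using fin ne unfolding is_matroid_of_rank_def is_matroid_def by blast
qed

lemma partition_bases_superset:
  assumes fin: "finite E" and P: "P \<subseteq> E" "inj_on c P" "k = Suc (card P)"
  shows "{T \<in> partition_bases c E k. P \<subseteq> T} = (\<lambda>z. insert z P) ` {z \<in> E. c z \<notin> c ` P}"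
    (is "?L = ?R")
proof
  have finP: "finite P" using fin P finite_subset by blast
  show "?L \<subseteq> ?R"
  proof
    fix T assume "T \<in> ?L"
    then have T: "T \<subseteq> E" "card T = k" "inj_on c T" "P \<subseteq> T"
      by (auto simp: partition_bases_def)
    then have "card (T - P) = 1" using finP P by (simp add: card_Diff_subset)
    then obtain z where z: "T - P = {z}" by (auto simp: card_1_singleton_iff)
    then have "T = insert z P" using T by blast
    moreover have "z \<in> E" "c z \<notin> c ` P"
      using z T by (blast dest: inj_onD)+
    ultimately show "T \<in> ?R" by blast
  qed
  show "?R \<subseteq> ?L"
  proof
    fix T assume "T \<in> ?R"
    then obtain z where z: "z \<in> E" "c z \<notin> c ` P" "T = insert z P" by blast
    then have "z \<notin> P" by blast
    then show "T \<in> ?L"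
      using z P finP by (simp add: partition_bases_def inj_on_insert subset_insertI)
  qed
qed

text \<open>A uniform basis above \<open>P\<close> is \<open>P\<close> together with a uniform
  element of \<open>C\<close>. The count in \<open>F\<close> is thus a constant plus the indicator
  that the added element lies in \<open>F\<close>.\<close>

lemma expectation_card_partition_bases_superset:
  assumes fin: "finite E" and P: "P \<subseteq> E" "inj_on c P" "k = Suc (card P)"
    and C: "C = {z \<in> E. c z \<notin> c ` P}" "C \<noteq> {}"
  shows "measure_pmf.expectation (pmf_of_set {T \<in> partition_bases c E k. P \<subseteq> T})
      (\<lambda>B. real (card (B \<inter> F))) = real (card (P \<inter> F)) + real (card (C \<inter> F)) / real (card C)"
proof -
  have finP: "finite P" using fin P finite_subset by blast
  have finC: "finite C" using fin C by auto
  have notin: "z \<notin> P" if "z \<in> C" for z using that C by auto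
  have inj: "inj_on (\<lambda>z. insert z P) C"
    using notin by (auto simp: inj_on_def)
  have eq: "{T \<in> partition_bases c E k. P \<subseteq> T} = (\<lambda>z. insert z P) ` C"
    using partition_bases_superset[OF fin P] C by simp
  have card_insert: "real (card (insert z P \<inter> F)) = real (card (P \<inter> F)) + (if z \<in> F then 1 else 0)"
    if "z \<in> C" for z
    using notin[OF that] finP by (auto simp: Int_insert_left)
  have "measure_pmf.expectation (pmf_of_set ((\<lambda>z. insert z P) ` C)) (\<lambda>B. real (card (B \<inter> F)))
      = (\<Sum>z\<in>C. real (card (insert z P \<inter> F))) / real (card C)"
    using finC C inj by (simp add: integral_pmf_of_set sum.reindex card_image)
  also have "(\<Sum>z\<in>C. real (card (insert z P \<inter> F)))
      = real (card C) * real (card (P \<inter> F)) + real (card (C \<inter> F))"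
    using finC by (simp add: card_insert sum.distrib sum.If_cases)
  finally show ?thesis
    using finC C(2) unfolding eq by (simp add: add_divide_distrib)
qed

section \<open>Lower bounds for the Wasserstein distance\<close>

text \<open>The easy half of Kantorovich duality.\<close>

lemma wasserstein_ge_expectation_diff:
  assumes fin: "finite (set_pmf \<mu>)" "finite (set_pmf \<nu>)"
    and lip: "\<And>x y. x \<in> set_pmf \<mu> \<Longrightarrow> y \<in> set_pmf \<nu> \<Longrightarrow> f y - f x \<le> real (d x y)"
  shows "measure_pmf.expectation \<nu> f - measure_pmf.expectation \<mu> f \<le> wasserstein d \<mu> \<nu>"
  unfolding wasserstein_def
proof (rule cINF_greatest)
  \<comment> \<open>The product coupling shows that the infimum is not taken over the empty
    set.\<close>
  have "pair_pmf \<mu> \<nu> \<in> couplings \<mu> \<nu>"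
    by (simp add: couplings_def map_fst_pair_pmf map_snd_pair_pmf)
  then show "couplings \<mu> \<nu> \<noteq> {}" by blast
next
  fix \<pi> assume "\<pi> \<in> couplings \<mu> \<nu>"
  then have \<mu>: "\<mu> = map_pmf fst \<pi>" and \<nu>: "\<nu> = map_pmf snd \<pi>"
    by (auto simp: couplings_def)
  have sub: "set_pmf \<pi> \<subseteq> set_pmf \<mu> \<times> set_pmf \<nu>" unfolding \<mu> \<nu> by force
  then have fin\<pi>: "finite (set_pmf \<pi>)" using fin by (meson finite_SigmaI finite_subset)
  note int = integrable_measure_pmf_finite[OF fin\<pi>]
  have "measure_pmf.expectation \<nu> f - measure_pmf.expectation \<mu> f
      = measure_pmf.expectation \<pi> (\<lambda>p. f (snd p) - f (fst p))"
    unfolding \<mu> \<nu> by (simp add: Bochner_Integration.integral_diff[OF int int])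
  also have "\<dots> \<le> measure_pmf.expectation \<pi> (\<lambda>(x, y). real (d x y))"
    using sub lip by (intro integral_mono_AE int) (auto simp: AE_measure_pmf_iff)
  finally show "measure_pmf.expectation \<nu> f - measure_pmf.expectation \<mu> f
      \<le> measure_pmf.expectation \<pi> (\<lambda>(x, y). real (d x y))" .
qed

section \<open>The walk and its metric\<close>

lemma set_pmf_basis_exchange_walk:
  assumes "is_matroid_of_rank E \<B> k" "0 < k" "S \<in> \<B>"
  shows "set_pmf (basis_exchange_walk \<B> S) = (\<Union>x\<in>S. {T \<in> \<B>. S - {x} \<subseteq> T})"
proof -
  have "finite \<B>"
    using assms(1) unfolding is_matroid_of_rank_def is_matroid_def
    by (meson finite_Pow_iff finite_subset)
  \<comment> \<open>Positive rank enters here: positive cardinality makes \<open>S\<close> finite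
    and nonempty, as the support of \<open>pmf_of_set\<close> requires.\<close>
  moreover have "finite S" "S \<noteq> {}"
    using assms by (auto simp: is_matroid_of_rank_def card_gt_0_iff)
  moreover have "{T \<in> \<B>. S - {x} \<subseteq> T} \<noteq> {}" for x using assms(3) by blast
  ultimately show ?thesis by (simp add: basis_exchange_walk_def)
qed

text \<open>Each step brings in at most one new element. \<open>kernel_power\<close> splits off the
  first step, so the induction has to vary the starting basis.\<close>

lemma card_Int_kernel_power_le:
  assumes M: "is_matroid_of_rank E \<B> k" "0 < k"
  shows "S \<in> \<B> \<Longrightarrow> T \<in> set_pmf (kernel_power (basis_exchange_walk \<B>) n S)
    \<Longrightarrow> card (T \<inter> F) \<le> card (S \<inter> F) + n"
proof (induction n arbitrary: S)
  case 0
  then show ?case by simp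
next
  case (Suc n)
  then obtain R where R: "R \<in> set_pmf (basis_exchange_walk \<B> S)"
    and T: "T \<in> set_pmf (kernel_power (basis_exchange_walk \<B>) n R)" by auto
  from R obtain x where x: "x \<in> S" "R \<in> \<B>" "S - {x} \<subseteq> R"
    using set_pmf_basis_exchange_walk[OF M Suc.prems(1)] by auto
  have card: "card S = k" "card R = k" using M Suc.prems x by (auto simp: is_matroid_of_rank_def)
  then have fin: "finite S" "finite R" using M(2) by (auto intro: card_ge_0_finite)
  \<comment> \<open>Bases have equal size, so as many elements enter as leave, and only
    \<open>x\<close> can leave.\<close>
  have "card (R - S) = card (S - R)"
    using card fin by (simp add: card_Diff_subset_Int Int_commute)
  also have "\<dots> \<le> card {x}" using x by (intro card_mono) auto
  finally have "card (R - S) \<le> 1" by simp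
  moreover have "card (R \<inter> F) \<le> card ((S \<inter> F) \<union> (R - S))"
    using fin by (intro card_mono) auto
  moreover have "\<dots> \<le> card (S \<inter> F) + card (R - S)" by (rule card_Un_le)
  ultimately have "card (R \<inter> F) \<le> card (S \<inter> F) + 1" by linarith
  with Suc.IH[OF x(2) T] show ?case by simp
qed

lemma card_Int_le_chain_dist:
  assumes M: "is_matroid_of_rank E \<B> k" "0 < k" and "S \<in> \<B>" "T \<in> \<B>"
  shows "card (T \<inter> F) \<le> card (S \<inter> F) + chain_dist (basis_exchange_walk \<B>) S T"
proof -
  let ?A = "{n. pmf (kernel_power (basis_exchange_walk \<B>) n S) T > 0}"
  \<comment> \<open>Irreducibility excludes the default value \<open>0\<close> of \<open>Inf\<close>
    on the empty set, so the infimum is attained.\<close>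
  have "?A \<noteq> {}"
    using basis_exchange_walk_irreducible[of E \<B> S T] assms
    by (auto simp: is_matroid_of_rank_def)
  then have "Inf ?A \<in> ?A" by (rule Inf_nat_def1)
  then show ?thesis
    using card_Int_kernel_power_le[OF M assms(3)]
    by (simp add: chain_dist_def pmf_positive_iff)
qed

lemma chain_dist_eq_1:
  assumes "y \<in> set_pmf (K x)" "x \<noteq> y"
  shows "chain_dist K x y = 1"
proof -
  let ?A = "{n. pmf (kernel_power K n x) y > 0}"
  have "1 \<in> ?A" using assms by (simp add: pmf_positive bind_return_pmf')
  moreover have "0 \<notin> ?A" using assms by simp
  ultimately show ?thesis
    unfolding chain_dist_def
    by (metis Inf_nat_def1 One_nat_def empty_iff le_less less_one wellorder_Inf_le1 neq0_conv)
qed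

text \<open>Counting elements of \<open>F\<close> is 1-Lipschitz for every \<open>F\<close>, by
  \<open>card_Int_le_chain_dist\<close>. Since \<open>F\<close> stays free, it can be tailored to
  \<open>S\<close> and \<open>T\<close>.\<close>

lemma wasserstein_basis_exchange_walk_ge:
  assumes M: "is_matroid_of_rank E \<B> k" "0 < k" and ST: "S \<in> \<B>" "T \<in> \<B>"
  defines "W \<equiv> basis_exchange_walk \<B>"
  shows "measure_pmf.expectation (W T) (\<lambda>B. real (card (B \<inter> F)))
       - measure_pmf.expectation (W S) (\<lambda>B. real (card (B \<inter> F)))
       \<le> wasserstein (chain_dist W) (W S) (W T)"
proof (rule wasserstein_ge_expectation_diff)
  have "finite \<B>"
    using M(1) unfolding is_matroid_of_rank_def is_matroid_def
    by (meson finite_Pow_iff finite_subset)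
  moreover have sub: "set_pmf (W R) \<subseteq> \<B>" if "R \<in> \<B>" for R
    unfolding W_def set_pmf_basis_exchange_walk[OF M that] by blast
  ultimately show "finite (set_pmf (W S))" "finite (set_pmf (W T))"
    using ST by (meson finite_subset)+
  show "real (card (y \<inter> F)) - real (card (x \<inter> F)) \<le> real (chain_dist W x y)"
    if "x \<in> set_pmf (W S)" "y \<in> set_pmf (W T)" for x y
    using card_Int_le_chain_dist[OF M, of x y F] that sub ST unfolding W_def by fastforce
qed

lemma expectation_basis_exchange_walk:
  assumes "finite \<B>" "finite S" "S \<noteq> {}" "S \<in> \<B>"
  shows "measure_pmf.expectation (basis_exchange_walk \<B> S) f =
    (\<Sum>x\<in>S. measure_pmf.expectation (pmf_of_set {T \<in> \<B>. S - {x} \<subseteq> T}) (f :: _ \<Rightarrow> real)) / card S"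
proof -
  have ne: "{T \<in> \<B>. S - {x} \<subseteq> T} \<noteq> {}" for x using assms by blast
  have "finite (set_pmf (pmf_of_set {T \<in> \<B>. S - {x} \<subseteq> T}))" for x
    using assms ne by simp
  then show ?thesis
    unfolding basis_exchange_walk_def using assms
    by (subst pmf_expectation_bind_pmf_of_set) (simp_all add: divide_inverse_commute sum_distrib_left)
qed

lemma ollivier_ricci_curvature_le:
  assumes "finite X" "x \<in> X" "y \<in> X" "x \<noteq> y"
  shows "ollivier_ricci_curvature X K
    \<le> 1 - wasserstein (chain_dist K) (K x) (K y) / real (chain_dist K x y)"
proof -
  \<comment> \<open>Finiteness makes the family bounded below, as \<open>cINF_lower2\<close>
    requires.\<close>
  have "finite {(x, y). x \<in> X \<and> y \<in> X \<and> x \<noteq> y}"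
    by (rule finite_subset[of _ "X \<times> X"]) (use assms(1) in auto)
  then show ?thesis
    unfolding ollivier_ricci_curvature_def
    using assms by (intro cINF_lower2[where x = "(x, y)"] bdd_below_finite finite_imageI) auto
qed

lemma independent_triple:
  fixes a b c :: "'v :: real_vector"
  assumes "a \<noteq> b" "a \<noteq> c" "b \<noteq> c"
    and "\<And>x y z. x *\<^sub>R a + y *\<^sub>R b + z *\<^sub>R c = 0 \<Longrightarrow> x = 0 \<and> y = 0 \<and> z = 0"
  shows "independent {a, b, c}"
proof
  assume "dependent {a, b, c}"
  then obtain f where "\<exists>v\<in>{a, b, c}. f v \<noteq> 0" "(\<Sum>v\<in>{a, b, c}. f v *\<^sub>R v) = 0"
    by (subst (asm) dependent_finite) auto
  then show False using assms(1-3) assms(4)[of "f a" "f b" "f c"] by (auto simp: add.assoc)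
qed

theorem mainTheorem3:
  fixes s t u u' :: 'a and v w :: "nat \<Rightarrow> 'a"
    and E :: "'a set" and \<B> :: "'a set set"
    and \<phi> :: "'a \<Rightarrow> real ^ 3"
  assumes distinct: "distinct ([s, t, u, u'] @ map v [1..<6] @ map w [1..<6])"
    and E: "E = {s, t, u, u'} \<union> v ` {1..5} \<union> w ` {1..5}"
    and \<B>: "\<B> = {{s, u, u'}, {t, u, u'}, {s, t, u}, {s, t, u'}}
      \<union> (\<Union>i\<in>{1..5}. {{s, u, v i}, {s, u', v i}})
      \<union> (\<Union>i\<in>{1..5}. {{t, u, w i}, {t, u', w i}})
      \<union> (\<Union>i\<in>{1..5}. {{u, u', v i}, {u, u', w i}})
      \<union> (\<Union>i\<in>{1..5}. \<Union>j\<in>{1..5}. {{u, v i, w j}, {u', v i, w j}})"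
    and \<phi>: "\<phi> s = vector [1, 0, 0]" "\<phi> t = vector [0, 1, 0]"
      "\<phi> u = vector [0, 0, 1]" "\<phi> u' = vector [1, 1, 1]"
      "\<And>i. i \<in> {1..5} \<Longrightarrow> \<phi> (v i) = vector [0, 1, 0]"
      "\<And>i. i \<in> {1..5} \<Longrightarrow> \<phi> (w i) = vector [1, 0, 0]"
  shows "is_matroid_of_rank E \<B> 3
    \<and> \<B> = linear_bases \<phi> E 3
    \<and> ollivier_ricci_curvature \<B> (basis_exchange_walk \<B>) \<le> - 1 / 21
    \<and> negatively_curved \<B> (basis_exchange_walk \<B>)"
proof -

  \<comment> \<open>The bases, sorted by parallel class\<close>
  define I :: "nat set" where "I = {1..5}"
  have finI: "finite I" and cardI: "card I = 5" by (simp_all add: I_def)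
  have setI: "set [1..<6] = I" by (auto simp: I_def)
  have neq: "s \<noteq> t" "s \<noteq> u" "s \<noteq> u'" "t \<noteq> u" "t \<noteq> u'" "u \<noteq> u'"
    and v_notin: "\<And>i. i \<in> I \<Longrightarrow> v i \<notin> {s, t, u, u'}"
    and w_notin: "\<And>i. i \<in> I \<Longrightarrow> w i \<notin> {s, t, u, u'}"
    and vw: "v ` I \<inter> w ` I = {}"
    and inj: "inj_on v I" "inj_on w I"
    using distinct unfolding distinct_append distinct_map set_append set_map setI by auto
  \<comment> \<open>\<open>X\<close> and \<open>Y\<close> are the parallel classes of (1,0,0) and
    (0,1,0): \<open>s\<close> goes with the \<open>w i\<close>, and \<open>t\<close> with the
    \<open>v i\<close>.\<close>
  define X where "X = insert s (w ` I)"
  define Y where "Y = insert t (v ` I)"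
  have E': "E = X \<union> Y \<union> {u, u'}" unfolding E X_def Y_def I_def by auto
  then have inE: "x \<in> X \<Longrightarrow> x \<in> E" "x \<in> Y \<Longrightarrow> x \<in> E" "u \<in> E" "u' \<in> E" for x
    by auto
  have finE: "finite E" unfolding E by simp
  \<comment> \<open>An opaque name for triples: automation would split equations between explicit sets.\<close>
  define tri where "tri a b c = {a, b, c}" for a b c :: 'a
  have tri_perm: "tri a c b = tri a b c" "tri b a c = tri a b c" "tri b c a = tri a b c"
    "tri c a b = tri a b c" "tri c b a = tri a b c" for a b c
    by (auto simp: tri_def)
  have "\<B> = {tri s u u', tri t u u', tri s t u, tri s t u'}
      \<union> (\<Union>i\<in>I. {tri s (v i) u, tri s (v i) u'})
      \<union> (\<Union>i\<in>I. {tri (w i) t u, tri (w i) t u'})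
      \<union> (\<Union>i\<in>I. {tri (v i) u u', tri (w i) u u'})
      \<union> (\<Union>i\<in>I. \<Union>j\<in>I. {tri (w j) (v i) u, tri (w j) (v i) u'})"
    unfolding \<B> I_def tri_def by (simp add: insert_commute)
  \<comment> \<open>The classes of \<open>u\<close> and \<open>u'\<close> are singletons, so a basis
    contains either exactly one of them and one element each of \<open>X\<close> and
    \<open>Y\<close>, or both and one element of either class.\<close>
  then have \<B>': "\<B> = (\<Union>x\<in>X. \<Union>y\<in>Y. {tri x y u, tri x y u'}) \<union> (\<Union>z\<in>X \<union> Y. {tri z u u'})"
    unfolding X_def Y_def by (rule ssubst) auto

  \<comment> \<open>Listed, linear and partition bases agree\<close>
  define e1 e2 e3 e4 :: "real ^ 3"
    where e: "e1 = vector [1, 0, 0]" "e2 = vector [0, 1, 0]" "e3 = vector [0, 0, 1]"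
      "e4 = vector [1, 1, 1]"
  have e_neq: "e1 \<noteq> e2" "e1 \<noteq> e3" "e1 \<noteq> e4" "e2 \<noteq> e3" "e2 \<noteq> e4" "e3 \<noteq> e4"
    by (auto simp: e vec_eq_iff forall_3)
  have \<phi>X: "\<phi> x = e1" if "x \<in> X" for x using that \<phi> by (auto simp: X_def I_def e)
  have \<phi>Y: "\<phi> y = e2" if "y \<in> Y" for y using that \<phi> by (auto simp: Y_def I_def e)
  have \<phi>u: "\<phi> u = e3" "\<phi> u' = e4" using \<phi> by (auto simp: e)
  note \<phi>_simps = \<phi>X \<phi>Y \<phi>u e_neq e_neq[symmetric]
  have indep: "independent {e1, e2, e3}" "independent {e1, e2, e4}"
      "independent {e1, e3, e4}" "independent {e2, e3, e4}"
    by (rule independent_triple; (simp add: e_neq)?; auto simp: e vec_eq_iff forall_3)+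

  have tri_linear: "tri a b c \<in> linear_bases \<phi> E 3"
    if "a \<in> E" "b \<in> E" "c \<in> E" "\<phi> a \<noteq> \<phi> b" "\<phi> a \<noteq> \<phi> c" "\<phi> b \<noteq> \<phi> c"
      "independent {\<phi> a, \<phi> b, \<phi> c}" for a b c
  proof -
    have "card {a, b, c} = 3" "inj_on \<phi> {a, b, c}"
      using that by (auto simp: card_insert_if)
    then show ?thesis
      using that by (simp add: linear_bases_def tri_def)
  qed
  \<comment> \<open>A cycle of three inclusions yields both equalities. Independence is checked only
    for listed sets; in the other direction, injectivity of the vector map suffices.\<close>
  have 1: "\<B> \<subseteq> linear_bases \<phi> E 3"
  proof
    fix A assume "A \<in> \<B>"
    then consider x y where "x \<in> X" "y \<in> Y" "A = tri x y u"
      | x y where "x \<in> X" "y \<in> Y" "A = tri x y u'"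
      | x where "x \<in> X" "A = tri x u u'"
      | y where "y \<in> Y" "A = tri y u u'"
      unfolding \<B>' by blast
    then show "A \<in> linear_bases \<phi> E 3"
      by cases (simp_all add: tri_linear inE \<phi>_simps indep)
  qed
  have 2: "linear_bases \<phi> E 3 \<subseteq> partition_bases \<phi> E 3"
    by (auto simp: linear_bases_def partition_bases_def)
  have 3: "partition_bases \<phi> E 3 \<subseteq> \<B>"
  proof
    fix A assume "A \<in> partition_bases \<phi> E 3"
    then obtain a b c where A: "A = {a, b, c}" "a \<in> E" "b \<in> E" "c \<in> E"
      and "a \<noteq> b" "a \<noteq> c" "b \<noteq> c" "inj_on \<phi> {a, b, c}"
      by (auto simp: partition_bases_def card_3_iff)
    then have neq: "\<phi> a \<noteq> \<phi> b" "\<phi> a \<noteq> \<phi> c" "\<phi> b \<noteq> \<phi> c"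
      by (auto simp: inj_on_def)
    have XY: "tri x y u \<in> \<B>" "tri x y u' \<in> \<B>" if "x \<in> X" "y \<in> Y" for x y
      using that unfolding \<B>' by blast+
    have Z: "tri z u u' \<in> \<B>" if "z \<in> X \<or> z \<in> Y" for z
      using that unfolding \<B>' by blast
    \<comment> \<open>The elements of an arbitrary basis come in no particular order, so membership
      is recorded for all orderings.\<close>
    have mem: "tri x y u \<in> \<B> \<and> tri x u y \<in> \<B> \<and> tri y x u \<in> \<B>
        \<and> tri y u x \<in> \<B> \<and> tri u x y \<in> \<B> \<and> tri u y x \<in> \<B>"
      "tri x y u' \<in> \<B> \<and> tri x u' y \<in> \<B> \<and> tri y x u' \<in> \<B>
        \<and> tri y u' x \<in> \<B> \<and> tri u' x y \<in> \<B> \<and> tri u' y x \<in> \<B>"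
      if "x \<in> X" "y \<in> Y" for x y
      using XY[OF that] by (simp_all add: tri_perm[where a = x and b = y])
    have mem': "tri z u u' \<in> \<B> \<and> tri z u' u \<in> \<B> \<and> tri u z u' \<in> \<B>
        \<and> tri u' z u \<in> \<B> \<and> tri u u' z \<in> \<B> \<and> tri u' u z \<in> \<B>"
      if "z \<in> X \<or> z \<in> Y" for z
      using Z[OF that] by (simp add: tri_perm[where a = z and b = u and c = u'])
    have cases: "z \<in> X \<or> z \<in> Y \<or> z = u \<or> z = u'" if "z \<in> E" for z
      using that unfolding E' by blast
    have "tri a b c \<in> \<B>"
      \<comment> \<open>Of the 64 assignments of classes, those that repeat a class contradict
        \<open>neq\<close>.\<close>
      using cases[OF A(2)] cases[OF A(3)] cases[OF A(4)] neq
      by (elim disjE) (simp_all add: \<phi>X \<phi>Y \<phi>u mem mem')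
    then show "A \<in> \<B>" using A(1) by (simp add: tri_def)
  qed
  have lin: "\<B> = linear_bases \<phi> E 3" and part: "\<B> = partition_bases \<phi> E 3"
    using 1 2 3 by auto

  \<comment> \<open>The curvature estimate\<close>
  define S T where "S = {s, u, u'}" and "T = {t, u, u'}"
  have ST: "S \<in> \<B>" "T \<in> \<B>" unfolding S_def T_def \<B> by simp_all
  have matroid: "is_matroid_of_rank E \<B> 3"
    unfolding part using finE ST part by (intro is_matroid_of_rank_partition_bases) auto
  have fin\<B>: "finite \<B>" unfolding part partition_bases_def using finE by simp

  \<comment> \<open>\<open>F\<close> mixes two classes on purpose. While \<open>t\<close> is kept,
    every \<open>w i\<close> can be added; while \<open>s\<close> is kept, the \<open>w i\<close>
    are blocked and only \<open>t\<close> can add to the count.\<close>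
  define F where "F = insert t (w ` I)"
  let ?h = "\<lambda>B. real (card (B \<inter> F))"
  let ?g = "\<lambda>P. measure_pmf.expectation (pmf_of_set {B \<in> \<B>. P \<subseteq> B}) ?h"
  have sX: "s \<in> X" and tY: "t \<in> Y" by (auto simp: X_def Y_def)
  have cardw: "card (w ` I) = 5" and cardv: "card (v ` I) = 5"
    using inj cardI by (simp_all add: card_image)
  \<comment> \<open>After dropping one of \<open>u\<close>, \<open>u'\<close>, the other one remains; call it \<open>a\<close>.\<close>
  have g_s: "?g {s, a} = 1 / 7" if ab: "a = u \<and> b = u' \<or> a = u' \<and> b = u" for a b
  proof -
    \<comment> \<open>The seven candidates are \<open>b\<close>, \<open>t\<close> and the five
      \<open>v i\<close>; only \<open>t\<close> lies in \<open>F\<close>.\<close>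
    let ?C = "insert b Y"
    have C: "?C = {z \<in> E. \<phi> z \<notin> \<phi> ` {s, a}}"
      unfolding E' using ab sX by (auto simp: \<phi>_simps)
    have "?C \<inter> F = {t}" "{s, a} \<inter> F = {}"
      using ab neq v_notin w_notin vw by (auto simp: F_def Y_def)
    moreover have "card ?C = 7"
      using ab neq v_notin cardv finI by (auto simp: Y_def card_insert_if)
    moreover have "{s, a} \<subseteq> E" "inj_on \<phi> {s, a}" "card {s, a} = 2"
      using ab neq sX by (auto simp: E' \<phi>_simps)
    ultimately show ?thesis
      unfolding part
      by (subst expectation_card_partition_bases_superset[OF finE _ _ _ C]) auto
  qed
  have g_t: "?g {t, a} = 12 / 7" if ab: "a = u \<and> b = u' \<or> a = u' \<and> b = u" for a b
  proof -
    \<comment> \<open>The seven candidates are \<open>b\<close>, \<open>s\<close> and the five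
      \<open>w i\<close>. The kept \<open>t\<close> contributes 1 and the \<open>w i\<close>
      contribute 5/7.\<close>
    let ?C = "insert b X"
    have C: "?C = {z \<in> E. \<phi> z \<notin> \<phi> ` {t, a}}"
      unfolding E' using ab tY by (auto simp: \<phi>_simps)
    have "?C \<inter> F = w ` I" "{t, a} \<inter> F = {t}"
      using ab neq w_notin by (auto simp: F_def X_def)
    moreover have "card ?C = 7"
      using ab neq w_notin cardw finI by (auto simp: X_def card_insert_if)
    moreover have "{t, a} \<subseteq> E" "inj_on \<phi> {t, a}" "card {t, a} = 2"
      using ab neq tY by (auto simp: E' \<phi>_simps)
    ultimately show ?thesis
      unfolding part
      by (subst expectation_card_partition_bases_superset[OF finE _ _ _ C]) (auto simp: cardw)
  qed

  let ?K = "basis_exchange_walk \<B>"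
  have minus: "S - {s} = {u, u'}" "S - {u} = {s, u'}" "S - {u'} = {s, u}"
    "T - {t} = {u, u'}" "T - {u} = {t, u'}" "T - {u'} = {t, u}"
    using neq by (auto simp: S_def T_def)
  have "measure_pmf.expectation (?K S) ?h = (\<Sum>x\<in>S. ?g (S - {x})) / card S"
    using fin\<B> ST by (intro expectation_basis_exchange_walk) (auto simp: S_def)
  also have "\<dots> = (?g {u, u'} + ?g {s, u'} + ?g {s, u}) / 3"
    using neq minus by (simp add: S_def)
  finally have ES: "measure_pmf.expectation (?K S) ?h = (?g {u, u'} + 2 / 7) / 3"
    using g_s[of u u'] g_s[of u' u] by simp
  have "measure_pmf.expectation (?K T) ?h = (\<Sum>x\<in>T. ?g (T - {x})) / card T"
    using fin\<B> ST by (intro expectation_basis_exchange_walk) (auto simp: T_def)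
  also have "\<dots> = (?g {u, u'} + ?g {t, u'} + ?g {t, u}) / 3"
    using neq minus by (simp add: T_def)
  finally have ET: "measure_pmf.expectation (?K T) ?h = (?g {u, u'} + 24 / 7) / 3"
    using g_t[of u u'] g_t[of u' u] by simp
  \<comment> \<open>Here \<open>x\<close> stands for \<open>?g {u, u'}\<close>, which occurs in both
    means because \<open>S - {s} = T - {t}\<close>. It cancels and is never evaluated.\<close>
  have "(x + 24 / 7) / 3 - (x + 2 / 7) / 3 = 22 / 21" for x :: real
    by (simp add: field_simps)
  then have W: "22 / 21 \<le> wasserstein (chain_dist ?K) (?K S) (?K T)"
    using wasserstein_basis_exchange_walk_ge[OF matroid zero_less_numeral ST, of F]
    unfolding ES ET by (simp only:)
  have neST: "S \<noteq> T" using neq by (auto simp: S_def T_def)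
  \<comment> \<open>Dropping \<open>s\<close> from \<open>S\<close> leaves a subset of
    \<open>T\<close>, so \<open>T\<close> is one step away.\<close>
  have "T \<in> set_pmf (?K S)"
    using set_pmf_basis_exchange_walk[OF matroid _ ST(1)] ST(2) by (auto simp: S_def T_def)
  then have "chain_dist ?K S T = 1" using neST by (rule chain_dist_eq_1)
  then have "ollivier_ricci_curvature \<B> ?K \<le> - 1 / 21"
    using ollivier_ricci_curvature_le[OF fin\<B> ST neST, of ?K] W by simp
  then show ?thesis
    using matroid lin by (simp add: negatively_curved_def)
qed

end
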